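(* Consider the Gaussian linear regression model $\mathbf{y}=X\boldsymbol{\beta}+\boldsymbol{\epsilon}$, $\boldsymbol{\epsilon}\sim N(\mathbf{0},\sigma^2 I_n)$, under structural constraints (a fixed collection of admissible models), with $r=\mathrm{rank}(X)$ and $m(k)$ the number of admissible models of size $k$, and let $1\le p_0\le r$. There exists a universal constant $C>0$ such that $$\inf_{\tilde{\mathbf{y}}}\ \sup_{\boldsymbol{\beta}_M:\,M\in\mathfrak{M}_{p_0}}\mathbb{E}\|\tilde{\mathbf{y}}-X\boldsymbol{\beta}_M\|^2\ \ge\ \begin{cases} C\sigma^2\max\left\{\tau[2p_0]\,\dfrac{\ln m(p_0)}{\max(1,\ln p_0)},\ \tau[p_0]\,p_0\right\}, & 1\le p_0\le r/2,\\[2mm] C\sigma^2\,\tau[p_0]\,r, & r/2\le p_0\le r,\end{cases}$$ where the infimum is taken over all estimators $\tilde{\mathbf{y}}$ (based on $\mathbf{y}$) of the mean vector $X\boldsymbol{\beta}$.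
   Context: Model: $\mathbf{y}=X\boldsymbol{\beta}+\boldsymbol{\epsilon}$ with $\mathbf{y}\in\mathbb{R}^n$, design matrix $X\in\mathbb{R}^{n\times p}$ with columns (predictors) $X_1,\ldots,X_p$ (possibly $p>n$), $\boldsymbol{\epsilon}\sim N(\mathbf{0},\sigma^2I_n)$, $\sigma^2>0$ known. Let $r=\mathrm{rank}(X)\le\min(p,n)$; it is assumed that any $r$ columns of $X$ are linearly independent. A model $M$ is a subset of the predictors and $|M|$ is its number of predictors. Structural constraints: a fixed known set of admissible models, restricted to sizes at most $r$. $\mathcal{M}_k$ is the set of admissible models of size $k$ and $m(k)=\mathrm{card}(\mathcal{M}_k)$, so $0\le m(k)\le\binom{p}{k}$. The null model (no predictors) is admissible, so $m(0)=1$. All models of size $r$ are identified with a single saturated model, represented by a fixed set of $r$ columns, so $m(r)=1$. $\mathfrak{M}_{p_0}=\bigcup_{k=0}^{p_0}\mathcal{M}_k$ is the set of admissible models with at most $p_0$ predictors. For a model $M$, $\boldsymbol{\beta}_M\in\mathbb{R}^p$ denotes a coefficient vector with $\beta_{Mj}\neq0$ iff $X_j\in M$. The supremum is over all such vectors with $M\in\mathfrak{M}_{p_0}$, and the expectation is under $\mathbf{y}=X\boldsymbol{\beta}_M+\boldsymbol{\epsilon}$. Sparse eigenvalues: with $\|\boldsymbol{\beta}\|_0$ the number of nonzero entries of $\boldsymbol{\beta}$, for $k=1,\ldots,r$, $$\phi_{min}[k]=\min_{\boldsymbol{\beta}:1\le\|\boldsymbol{\beta}\|_0\le k}\frac{\|X\boldsymbol{\beta}\|^2}{\|\boldsymbol{\beta}\|^2},\qquad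 \phi_{max}[k]=\max_{\boldsymbol{\beta}:1\le\|\boldsymbol{\beta}\|_0\le k}\frac{\|X\boldsymbol{\beta}\|^2}{\|\boldsymbol{\beta}\|^2},\qquad \tau[k]=\frac{\phi_{min}[k]}{\phi_{max}[k]}.$$ Convention: $\ln 0=-\infty$. "Universal" means that $C$ does not depend on $n,p,X,\sigma^2,p_0$ or the set of admissible models.
   Formalization: It is additionally assumed that m(p_0) ≥ 1, i.e. some admissible model has exactly p_0 predictors; otherwise the bound fails, e.g. X = I_r with r ≥ 2, only the null and saturated models admissible, and p_0 = 1. *)

theory Defs
  imports "HOL-Probability.Probability" "Jordan_Normal_Form.DL_Rank"
begin

text \<open>
  Vectors and matrices are those of \<open>Jordan_Normal_Form.Matrix\<close>, with dimensions carried by the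
  objects, so that a constant can be quantified outside the dimensions. The notation and type of the
  same name for vectors indexed by a finite type are switched off.
\<close>

no_notation Finite_Cartesian_Product.vec_nth (infixl \<open>$\<close> 90)
no_notation Inner_Product.real_inner_class.inner (infix \<open>\<bullet>\<close> 70)
hide_type (open) Finite_Cartesian_Product.vec
hide_const (open) Finite_Cartesian_Product.vec

subsection \<open>Design matrices\<close>

definition sq_norm_rvec :: "real vec \<Rightarrow> real" where
  "sq_norm_rvec v = v \<bullet> v"

definition supp_vec :: "real vec \<Rightarrow> nat set" where
  "supp_vec v = {j. j < dim_vec v \<and> v $ j \<noteq> 0}"

text \<open>
  Linear independence of a family of columns: without injectivity, a repeated column would
  collapse in the image set and go unnoticed.
\<close>

definition (in vec_space) lin_indpt_cols :: "'a mat \<Rightarrow> nat set \<Rightarrow> bool" where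
  "lin_indpt_cols A J \<longleftrightarrow> inj_on (col A) J \<and> lin_indpt (col A ` J)"

definition mat_rank :: "real mat \<Rightarrow> nat" where
  "mat_rank X = vec_space.rank (dim_row X) X"

definition any_rank_cols_indpt :: "real mat \<Rightarrow> bool" where
  "any_rank_cols_indpt X \<longleftrightarrow>
     (\<forall>J. J \<subseteq> {..<dim_col X} \<and> card J = mat_rank X \<longrightarrow>
        vec_space.lin_indpt_cols (dim_row X) X J)"

text \<open>
  The set of Rayleigh quotients over \<open>1 \<le> \<parallel>\<beta>\<parallel>\<^sub>0 \<le> k\<close>. By homogeneity this is the range of a
  continuous function on a compact set, so its infimum and supremum are attained whenever the
  set is nonempty, that is, for \<open>k \<ge> 1\<close> and \<open>dim_col X \<ge> 1\<close>.
\<close>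

definition sparse_rayleigh :: "real mat \<Rightarrow> nat \<Rightarrow> real set" where
  "sparse_rayleigh X k =
     {sq_norm_rvec (X *\<^sub>v b) / sq_norm_rvec b | b.
        b \<in> carrier_vec (dim_col X) \<and> 1 \<le> card (supp_vec b) \<and> card (supp_vec b) \<le> k}"

definition phi_min :: "real mat \<Rightarrow> nat \<Rightarrow> real" where
  "phi_min X k = Inf (sparse_rayleigh X k)"

definition phi_max :: "real mat \<Rightarrow> nat \<Rightarrow> real" where
  "phi_max X k = Sup (sparse_rayleigh X k)"

definition tau :: "real mat \<Rightarrow> nat \<Rightarrow> real" where
  "tau X k = phi_min X k / phi_max X k"

subsection \<open>Admissible models\<close>

text \<open>
  A model is the set of the column indices of its predictors. The last condition says that the
  only admissible model of size \<open>mat_rank X\<close> is the one that represents the saturated model.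
\<close>

definition models_of_size :: "nat set set \<Rightarrow> nat \<Rightarrow> nat set set" where
  "models_of_size A k = {M \<in> A. card M = k}"

definition models_up_to :: "nat set set \<Rightarrow> nat \<Rightarrow> nat set set" where
  "models_up_to A k = (\<Union>j\<le>k. models_of_size A j)"

definition admissible_family :: "real mat \<Rightarrow> nat set set \<Rightarrow> bool" where
  "admissible_family X A \<longleftrightarrow>
     (\<forall>M\<in>A. M \<subseteq> {..<dim_col X} \<and> card M \<le> mat_rank X) \<and>
     {} \<in> A \<and>
     card (models_of_size A (mat_rank X)) = 1"

subsection \<open>Gaussian observations and minimax risk\<close>

text \<open>The Borel sets of n-dimensional space, transported to \<^term>\<open>carrier_vec n\<close>.\<close>

definition borel_vec :: "nat \<Rightarrow> real vec measure" where
  "borel_vec n =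
     vimage_algebra (carrier_vec n) (\<lambda>v. \<lambda>i\<in>{..<n}. v $ i) (\<Pi>\<^sub>M i\<in>{..<n}. borel)"

definition gauss_noise :: "nat \<Rightarrow> real \<Rightarrow> real vec measure" where
  "gauss_noise n \<sigma> =
     distr (\<Pi>\<^sub>M i\<in>{..<n}. density lborel (normal_density 0 \<sigma>)) (borel_vec n) (vec n)"

text \<open>
  The estimators of the mean vector are all Borel functions of the observed vector; they are
  not required to have finite risk.
\<close>

definition estimators :: "nat \<Rightarrow> (real vec \<Rightarrow> real vec) set" where
  "estimators n = borel_vec n \<rightarrow>\<^sub>M borel_vec n"

definition risk :: "real mat \<Rightarrow> real \<Rightarrow> (real vec \<Rightarrow> real vec) \<Rightarrow> real vec \<Rightarrow> ennreal" where
  "risk X \<sigma> d b =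
     (\<integral>\<^sup>+ e. ennreal (sq_norm_rvec (d (X *\<^sub>v b + e) - X *\<^sub>v b)) \<partial>gauss_noise (dim_row X) \<sigma>)"

definition minimax_risk :: "real mat \<Rightarrow> real \<Rightarrow> nat set set \<Rightarrow> nat \<Rightarrow> ennreal" where
  "minimax_risk X \<sigma> A p0 =
     (INF d\<in>estimators (dim_row X).
        SUP b\<in>{b \<in> carrier_vec (dim_col X). supp_vec b \<in> models_up_to A p0}. risk X \<sigma> d b)"

end

theory Submission
  imports Defs
begin

text \<open>
  Estimation is at least as hard as testing. If an estimator had small risk at each of \<open>K\<close> mean
  vectors, then under each of them its value would be close to the true one with probability near 1.
  Replacing the true mean by a common reference mean at distance \<open>\<delta>\<close> changes probabilities in a
  controlled way (\<open>gauss_noise_change_of_mean\<close>): a likely event keeps probability of order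
  \<open>exp (- \<delta>\<^sup>2 / \<sigma>\<^sup>2)\<close>. Under the reference mean, however, the estimate can be close to few of the
  candidates at a time, so the \<open>K\<close> probabilities have a small sum. The two facts are incompatible as
  soon as \<open>\<delta>\<^sup>2\<close> is at most a fraction of \<open>\<sigma>\<^sup>2 * ln K\<close>
  (\<open>multiple_hypotheses_risk_lower_bound\<close>). So large risk follows from a set of means that is
  contained in a ball of squared radius of order \<open>\<sigma>\<^sup>2 * ln K\<close> but whose points are separated by a
  comparable distance.

  Such means come from families of sets of predictors. For coefficient vectors built from
  indicators with a common amplitude, squared distances of coefficients are Hamming distances, and the sparse
  eigenvalues carry them over to the means; the ratio of the upper and the lower bound is where
  \<open>tau\<close> enters. With the best amplitude, a family \<open>F\<close> of sets contained in a Hamming ball of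
  radius \<open>R\<close> and separated at distance \<open>D\<close> gives the bound \<open>\<sigma>\<^sup>2 * tau * (D / R) * ln (card F)\<close>, up to a
  constant (\<open>minimax_risk_ge_of_set_family\<close>).

  The two terms of the theorem use two families. For \<open>p0\<close> one takes all subsets of a single
  admissible model of size \<open>p0\<close> (\<open>minimax_risk_ge_dimension\<close>). For \<open>ln m(p0)\<close> one takes
  admissible models themselves. These may be badly spread, but a multiscale argument finds one of
  about \<open>ln p0\<close> dyadic scales at which a subfamily has radius and separation comparable to that scale
  and a logarithmic size of at least its share of \<open>ln m(p0)\<close>
  (\<open>local_packing_at_some_scale\<close>, \<open>minimax_risk_ge_log_card_models\<close>).
\<close>

section \<open>Translating Gaussian noise\<close>

abbreviation normal_measure :: "real \<Rightarrow> real measure" where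
  "normal_measure \<sigma> \<equiv> density lborel (\<lambda>x. ennreal (normal_density 0 \<sigma> x))"

text \<open>
  The likelihood ratio of two normal laws whose means differ by \<open>h\<close> has second moment
  \<open>exp (h\<^sup>2 / \<sigma>\<^sup>2)\<close>, and Cauchy--Schwarz turns this into a comparison of expectations. The
  inequality is kept in squared form because this makes it stable under products: no square root
  has to be pulled out of an inner integral.
\<close>

lemma normal_shift_second_moment:
  fixes g :: "real \<Rightarrow> ennreal"
  assumes [measurable]: "g \<in> borel_measurable borel" and \<sigma>: "\<sigma> > 0"
  shows "(\<integral>\<^sup>+x. g (x + h) \<partial>normal_measure \<sigma>)\<^sup>2
           \<le> ennreal (exp (h\<^sup>2 / \<sigma>\<^sup>2)) * (\<integral>\<^sup>+x. (g x)\<^sup>2 \<partial>normal_measure \<sigma>)"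
proof -
  define \<phi> where "\<phi> = normal_density 0 \<sigma>"
  have [measurable]: "\<phi> \<in> borel_measurable borel" unfolding \<phi>_def by simp
  have pos: "\<phi> x > 0" for x using \<sigma> by (simp add: \<phi>_def normal_density_pos)
  \<comment> \<open>For Cauchy--Schwarz, the shifted density is written as \<open>u * v\<close>, where \<open>u\<^sup>2\<close> is the
    original density and \<open>v\<^sup>2\<close> is again a normal density, shifted by \<open>2 * h\<close>, times a constant.\<close>
  define u where "u x = sqrt (\<phi> x)" for x
  define v where "v x = exp (h\<^sup>2 / (2 * \<sigma>\<^sup>2)) * sqrt (\<phi> (x - 2 * h))" for x
  have [measurable]: "u \<in> borel_measurable borel" "v \<in> borel_measurable borel"
    unfolding u_def[abs_def] v_def[abs_def] by measurable
  have u_pos: "u x \<ge> 0" and v_pos: "v x \<ge> 0" for x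
    by (simp_all add: u_def v_def less_imp_le[OF pos])
  have uu: "(u x)\<^sup>2 = \<phi> x" for x by (simp add: u_def less_imp_le[OF pos])
  have vv: "(v x)\<^sup>2 = exp (h\<^sup>2 / \<sigma>\<^sup>2) * \<phi> (x - 2 * h)" for x
    using \<sigma> by (simp add: v_def less_imp_le[OF pos] power_mult_distrib flip: exp_of_nat_mult)
  have uv: "u x * v x = \<phi> (x - h)" for x
  proof (rule power2_eq_imp_eq)
    have "- x\<^sup>2 / (2 * \<sigma>\<^sup>2) + h\<^sup>2 / \<sigma>\<^sup>2 + - (x - 2 * h)\<^sup>2 / (2 * \<sigma>\<^sup>2) = 2 * (- (x - h)\<^sup>2 / (2 * \<sigma>\<^sup>2))"
      using \<sigma> by (simp add: field_simps power2_eq_square)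
    then have "exp (- x\<^sup>2 / (2 * \<sigma>\<^sup>2)) * exp (h\<^sup>2 / \<sigma>\<^sup>2) * exp (- (x - 2 * h)\<^sup>2 / (2 * \<sigma>\<^sup>2))
               = (exp (- (x - h)\<^sup>2 / (2 * \<sigma>\<^sup>2)))\<^sup>2"
      by (simp flip: exp_add exp_of_nat_mult)
    then show "(u x * v x)\<^sup>2 = (\<phi> (x - h))\<^sup>2"
      unfolding power_mult_distrib uu vv
      by (simp add: \<phi>_def normal_density_def field_simps power2_eq_square)
  qed (use u_pos v_pos less_imp_le[OF pos] in auto)
  have "(\<integral>\<^sup>+x. g (x + h) \<partial>normal_measure \<sigma>) = (\<integral>\<^sup>+x. \<phi> x * g (x + h) \<partial>lborel)"
    by (subst nn_integral_density) (auto simp: \<phi>_def)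
  also have "\<dots> = (\<integral>\<^sup>+x. \<phi> (x - h) * g x \<partial>lborel)"
    by (subst nn_integral_real_affine[where c=1 and t="-h"]) (auto simp: algebra_simps)
  also have "\<dots> = (\<integral>\<^sup>+x. (ennreal (u x) * g x) * ennreal (v x) \<partial>lborel)"
    by (intro nn_integral_cong)
       (simp add: uv[symmetric] ennreal_mult u_pos v_pos mult_ac)
  finally have "(\<integral>\<^sup>+x. g (x + h) \<partial>normal_measure \<sigma>)\<^sup>2
      \<le> (\<integral>\<^sup>+x. (ennreal (u x) * g x)\<^sup>2 \<partial>lborel) * (\<integral>\<^sup>+x. (ennreal (v x))\<^sup>2 \<partial>lborel)"
    by (simp only:) (rule Cauchy_Schwarz_nn_integral; measurable)
  also have "(\<integral>\<^sup>+x. (ennreal (u x) * g x)\<^sup>2 \<partial>lborel) = (\<integral>\<^sup>+x. (g x)\<^sup>2 \<partial>normal_measure \<sigma>)"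
    by (subst nn_integral_density)
       (auto simp: power_mult_distrib ennreal_power u_pos uu \<phi>_def)
  also have "(\<integral>\<^sup>+x. (ennreal (v x))\<^sup>2 \<partial>lborel)
      = ennreal (exp (h\<^sup>2 / \<sigma>\<^sup>2)) * (\<integral>\<^sup>+x. \<phi> (x - 2 * h) \<partial>lborel)"
    by (subst nn_integral_cmult[symmetric])
       (auto simp: ennreal_power v_pos vv ennreal_mult less_imp_le[OF pos])
  also have "(\<integral>\<^sup>+x. \<phi> (x - 2 * h) \<partial>lborel) = (\<integral>\<^sup>+x. \<phi> x \<partial>lborel)"
    by (subst (2) nn_integral_real_affine[where c=1 and t="-2*h"]) (auto simp: algebra_simps)
  also have "\<dots> = 1"
    unfolding \<phi>_def using \<sigma>
    by (subst nn_integral_eq_integral) (auto simp: integral_normal_density)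
  finally show ?thesis by (simp add: mult_ac)
qed

text \<open>
  The one-dimensional inequality is applied to the new coordinate with the others fixed, and the
  induction hypothesis to the function \<open>G\<close> that results from integrating this coordinate out; the
  two constants multiply.
\<close>

lemma normal_PiM_shift_second_moment:
  fixes g :: "('i \<Rightarrow> real) \<Rightarrow> ennreal"
  assumes "finite I" and \<sigma>: "\<sigma> > 0" and "g \<in> borel_measurable (\<Pi>\<^sub>M i\<in>I. borel)"
  shows "(\<integral>\<^sup>+x. g (\<lambda>i\<in>I. x i + h i) \<partial>(\<Pi>\<^sub>M i\<in>I. normal_measure \<sigma>))\<^sup>2
           \<le> ennreal (exp ((\<Sum>i\<in>I. (h i)\<^sup>2) / \<sigma>\<^sup>2)) * (\<integral>\<^sup>+x. (g x)\<^sup>2 \<partial>(\<Pi>\<^sub>M i\<in>I. normal_measure \<sigma>))"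
  using assms(1,3)
proof (induction I arbitrary: g rule: finite_induct)
  case empty
  interpret product_sigma_finite "\<lambda>_::'i. normal_measure \<sigma>"
    by (intro product_sigma_finite.intro prob_space_imp_sigma_finite prob_space_normal_density \<sigma>)
  show ?case by (simp add: PiM_empty nn_integral_count_space_finite)
next
  case (insert i I)
  interpret product_sigma_finite "\<lambda>_::'i. normal_measure \<sigma>"
    by (intro product_sigma_finite.intro prob_space_imp_sigma_finite prob_space_normal_density \<sigma>)
  interpret sf: sigma_finite_measure "normal_measure \<sigma>" by (rule sigma_finite_measures)
  have S: "sets (\<Pi>\<^sub>M i\<in>J. normal_measure \<sigma>) = sets (\<Pi>\<^sub>M i\<in>J. (borel::real measure))" for J :: "'i set"
    by (intro sets_PiM_cong) auto
  note [measurable_cong] = S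
  note [measurable] = insert.prems
  define N where "N J = (\<Pi>\<^sub>M i\<in>J. normal_measure \<sigma>)" for J :: "'i set"
  note [measurable_cong] = S[folded N_def]
  define G where "G x = (\<integral>\<^sup>+y. g (x(i := y + h i)) \<partial>normal_measure \<sigma>)" for x
  have upd[measurable]: "(\<lambda>(x, y). x(i := y + c)) \<in> (\<Pi>\<^sub>M i\<in>I. borel) \<Otimes>\<^sub>M normal_measure \<sigma> \<rightarrow>\<^sub>M (\<Pi>\<^sub>M i\<in>insert i I. (borel::real measure))" for c
    unfolding split_beta' by (rule measurable_fun_upd[where J=I]) auto
  have G_meas[measurable]: "G \<in> borel_measurable (\<Pi>\<^sub>M i\<in>I. borel)"
  proof -
    have "(\<lambda>(x, y). g (x(i := y + h i))) \<in> borel_measurable ((\<Pi>\<^sub>M i\<in>I. borel) \<Otimes>\<^sub>M normal_measure \<sigma>)"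
      using measurable_compose[OF upd insert.prems] by (simp add: split_beta')
    then show ?thesis unfolding G_def by measurable
  qed
  have shift[measurable]: "(\<lambda>x. \<lambda>i\<in>J. x i + h i) \<in> (\<Pi>\<^sub>M i\<in>J. borel) \<rightarrow>\<^sub>M (\<Pi>\<^sub>M i\<in>J. (borel::real measure))" for J
    by measurable
  have "(\<integral>\<^sup>+x. g (\<lambda>j\<in>insert i I. x j + h j) \<partial>N (insert i I))
      = (\<integral>\<^sup>+x. (\<integral>\<^sup>+y. g (\<lambda>j\<in>insert i I. (x(i := y)) j + h j) \<partial>normal_measure \<sigma>) \<partial>N I)"
    unfolding N_def using insert.hyps by (intro product_nn_integral_insert) measurable
  also have "\<dots> = (\<integral>\<^sup>+x. G (\<lambda>j\<in>I. x j + h j) \<partial>N I)"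
    unfolding G_def using insert.hyps
    by (intro nn_integral_cong arg_cong[where f=g]) (auto simp: fun_eq_iff restrict_def)
  finally have outer: "(\<integral>\<^sup>+x. g (\<lambda>j\<in>insert i I. x j + h j) \<partial>N (insert i I))\<^sup>2
      \<le> ennreal (exp ((\<Sum>i\<in>I. (h i)\<^sup>2) / \<sigma>\<^sup>2)) * (\<integral>\<^sup>+x. (G x)\<^sup>2 \<partial>N I)"
    using insert.IH[OF G_meas] by (simp only: N_def)
  have "(\<integral>\<^sup>+x. (G x)\<^sup>2 \<partial>N I)
      \<le> (\<integral>\<^sup>+x. ennreal (exp ((h i)\<^sup>2 / \<sigma>\<^sup>2)) * (\<integral>\<^sup>+y. (g (x(i := y)))\<^sup>2 \<partial>normal_measure \<sigma>) \<partial>N I)"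
  proof (rule nn_integral_mono)
    fix x assume "x \<in> space (N I)"
    then have x: "x \<in> space (\<Pi>\<^sub>M i\<in>I. (borel::real measure))" by (simp add: N_def space_PiM)
    have [measurable]: "(\<lambda>y. g (x(i := y))) \<in> borel_measurable borel"
      using measurable_compose[OF measurable_Pair2[OF upd[of 0] x] insert.prems] by (simp add: fun_upd_def)
    show "(G x)\<^sup>2 \<le> ennreal (exp ((h i)\<^sup>2 / \<sigma>\<^sup>2)) * (\<integral>\<^sup>+y. (g (x(i := y)))\<^sup>2 \<partial>normal_measure \<sigma>)"
      unfolding G_def by (rule normal_shift_second_moment[OF _ \<sigma>, of "\<lambda>y. g (x(i := y))"]) measurable
  qed
  also have "\<dots> = ennreal (exp ((h i)\<^sup>2 / \<sigma>\<^sup>2)) * (\<integral>\<^sup>+x. (\<integral>\<^sup>+y. (g (x(i := y)))\<^sup>2 \<partial>normal_measure \<sigma>) \<partial>N I)"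
  proof (rule nn_integral_cmult)
    have "(\<lambda>(x, y). (g (x(i := y)))\<^sup>2) \<in> borel_measurable ((\<Pi>\<^sub>M i\<in>I. borel) \<Otimes>\<^sub>M normal_measure \<sigma>)"
      using measurable_compose[OF upd[of 0] insert.prems] by (simp add: split_beta')
    then show "(\<lambda>x. \<integral>\<^sup>+y. (g (x(i := y)))\<^sup>2 \<partial>normal_measure \<sigma>) \<in> borel_measurable (N I)"
      by measurable
  qed
  also have "(\<integral>\<^sup>+x. (\<integral>\<^sup>+y. (g (x(i := y)))\<^sup>2 \<partial>normal_measure \<sigma>) \<partial>N I) = (\<integral>\<^sup>+x. (g x)\<^sup>2 \<partial>N (insert i I))"
    unfolding N_def using insert.hyps by (intro product_nn_integral_insert[symmetric]) measurable
  finally have inner: "(\<integral>\<^sup>+x. (G x)\<^sup>2 \<partial>N I)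
      \<le> ennreal (exp ((h i)\<^sup>2 / \<sigma>\<^sup>2)) * (\<integral>\<^sup>+x. (g x)\<^sup>2 \<partial>N (insert i I))" .
  have "ennreal (exp ((\<Sum>i\<in>insert i I. (h i)\<^sup>2) / \<sigma>\<^sup>2))
      = ennreal (exp ((\<Sum>i\<in>I. (h i)\<^sup>2) / \<sigma>\<^sup>2)) * ennreal (exp ((h i)\<^sup>2 / \<sigma>\<^sup>2))"
    using insert.hyps by (simp add: add_divide_distrib exp_add ennreal_mult mult.commute)
  then show ?case
    using order_trans[OF outer mult_left_mono[OF inner zero_le]] by (simp only: N_def mult.assoc)
qed

section \<open>Gaussian noise on coordinate vectors\<close>

lemma space_borel_vec [simp]: "space (borel_vec n) = carrier_vec n"
  by (simp add: borel_vec_def)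

lemma measurable_vec_index [measurable (raw)]:
  assumes "f \<in> N \<rightarrow>\<^sub>M borel_vec n" "i < n"
  shows "(\<lambda>x. f x $ i) \<in> borel_measurable N"
proof -
  have "(\<lambda>v. \<lambda>i\<in>{..<n}. v $ i) \<in> borel_vec n \<rightarrow>\<^sub>M (\<Pi>\<^sub>M i\<in>{..<n}. (borel :: real measure))"
    unfolding borel_vec_def by (intro measurable_vimage_algebra1) (auto simp: space_PiM)
  from measurable_compose[OF this measurable_component_singleton[of i]] assms(2)
  have "(\<lambda>v. v $ i) \<in> borel_measurable (borel_vec n)"
    by simp
  from measurable_compose[OF assms(1) this] show ?thesis .
qed

lemma measurable_borel_vecI:
  assumes "\<And>x. x \<in> space N \<Longrightarrow> f x \<in> carrier_vec n"
    and "\<And>i. i < n \<Longrightarrow> (\<lambda>x. f x $ i) \<in> borel_measurable N"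
  shows "f \<in> N \<rightarrow>\<^sub>M borel_vec n"
  unfolding borel_vec_def
  using assms by (intro measurable_vimage_algebra2 measurable_restrict) auto

lemma measurable_vec_PiM [measurable]: "vec n \<in> (\<Pi>\<^sub>M i\<in>{..<n}. (borel :: real measure)) \<rightarrow>\<^sub>M borel_vec n"
  by (rule measurable_borel_vecI) auto

lemma measurable_vec_translate [measurable]:
  assumes "a \<in> carrier_vec n"
  shows "(+) a \<in> borel_vec n \<rightarrow>\<^sub>M borel_vec n"
proof (rule measurable_borel_vecI)
  fix i assume i: "i < n"
  have "(\<lambda>x. a $ i + x $ i) \<in> borel_measurable (borel_vec n)"
    by (intro borel_measurable_add measurable_vec_index[OF measurable_ident_sets[OF refl] i]) simp
  then show "(\<lambda>x. (a + x) $ i) \<in> borel_measurable (borel_vec n)"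
    by (rule measurable_cong[THEN iffD1, rotated]) (use i in auto)
qed (use assms in auto)

lemma sq_norm_rvec_sum: "v \<in> carrier_vec n \<Longrightarrow> sq_norm_rvec v = (\<Sum>i<n. (v $ i)\<^sup>2)"
  by (auto simp: sq_norm_rvec_def scalar_prod_def power2_eq_square lessThan_atLeast0)

lemma sq_norm_rvec_diff:
  assumes "x \<in> carrier_vec n" "y \<in> carrier_vec n"
  shows "sq_norm_rvec (x - y) = (\<Sum>i<n. (x $ i - y $ i)\<^sup>2)"
  using assms by (subst sq_norm_rvec_sum[of _ n]) auto

lemma sq_norm_rvec_nonneg [simp]: "sq_norm_rvec v \<ge> 0"
  by (subst sq_norm_rvec_sum[of _ "dim_vec v"]) (auto intro: sum_nonneg)

text \<open>
  Two points that are both within squared distance \<open>s\<close> of \<open>z\<close> are within squared distance \<open>4 * s\<close>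
  of each other, which is how an accurate estimate identifies the mean among separated candidates.
\<close>

lemma sq_norm_rvec_dist_triangle:
  assumes "x \<in> carrier_vec n" "y \<in> carrier_vec n" "z \<in> carrier_vec n"
  shows "sq_norm_rvec (x - y) \<le> 2 * sq_norm_rvec (z - x) + 2 * sq_norm_rvec (z - y)"
proof -
  have *: "(a - b)\<^sup>2 \<le> 2 * (c - a)\<^sup>2 + 2 * (c - b)\<^sup>2" for a b c :: real
    using zero_le_power2[of "2 * c - a - b"] by (simp add: power2_eq_square algebra_simps)
  have "(\<Sum>i<n. (x $ i - y $ i)\<^sup>2) \<le> (\<Sum>i<n. 2 * (z $ i - x $ i)\<^sup>2 + 2 * (z $ i - y $ i)\<^sup>2)"
    by (intro sum_mono *)
  also have "\<dots> = 2 * (\<Sum>i<n. (z $ i - x $ i)\<^sup>2) + 2 * (\<Sum>i<n. (z $ i - y $ i)\<^sup>2)"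
    by (simp only: sum.distrib sum_distrib_left)
  finally show ?thesis
    using assms by (simp only: sq_norm_rvec_diff)
qed

lemma measurable_sq_norm_dist:
  assumes "d \<in> borel_vec n \<rightarrow>\<^sub>M borel_vec n" "t \<in> carrier_vec n"
  shows "(\<lambda>y. sq_norm_rvec (d y - t)) \<in> borel_measurable (borel_vec n)"
proof -
  have "(\<lambda>y. \<Sum>i<n. (d y $ i - t $ i)\<^sup>2) \<in> borel_measurable (borel_vec n)"
    by (intro borel_measurable_sum borel_measurable_power borel_measurable_diff
        measurable_vec_index[OF assms(1)]) auto
  moreover have eq: "sq_norm_rvec (d y - t) = (\<Sum>i<n. (d y $ i - t $ i)\<^sup>2)" if "y \<in> space (borel_vec n)" for y
    using measurable_space[OF assms(1), of y] assms(2) that by (intro sq_norm_rvec_diff) auto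
  ultimately show ?thesis
    by (subst measurable_cong[OF eq])
qed

lemma sets_gauss_noise [measurable_cong, simp]: "sets (gauss_noise n \<sigma>) = sets (borel_vec n)"
  by (simp add: gauss_noise_def)

lemma space_gauss_noise [simp]: "space (gauss_noise n \<sigma>) = carrier_vec n"
  by (simp add: gauss_noise_def)

lemma sets_PiM_normal: "sets (\<Pi>\<^sub>M i\<in>I. normal_measure \<sigma>) = sets (\<Pi>\<^sub>M i\<in>I. (borel :: real measure))"
  by (intro sets_PiM_cong) auto

lemma measurable_vec_PiM_normal: "vec n \<in> (\<Pi>\<^sub>M i\<in>{..<n}. normal_measure \<sigma>) \<rightarrow>\<^sub>M borel_vec n"
  using measurable_vec_PiM measurable_cong_sets[OF sets_PiM_normal refl] by blast

lemma prob_space_gauss_noise: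
  assumes "\<sigma> > 0"
  shows "prob_space (gauss_noise n \<sigma>)"
  unfolding gauss_noise_def
  by (intro prob_space.prob_space_distr prob_space_PiM prob_space_normal_density
      measurable_vec_PiM_normal assms)

lemma nn_integral_gauss_noise:
  assumes "F \<in> borel_measurable (borel_vec n)"
  shows "(\<integral>\<^sup>+e. F e \<partial>gauss_noise n \<sigma>) = (\<integral>\<^sup>+x. F (vec n x) \<partial>(\<Pi>\<^sub>M i\<in>{..<n}. normal_measure \<sigma>))"
  using assms by (simp add: gauss_noise_def nn_integral_distr measurable_vec_PiM_normal)

text \<open>
  For \<open>F\<close> the indicator of an event this bounds the square of its probability under the mean \<open>a\<close> by
  a multiple of its probability under the mean \<open>b\<close>.
\<close>

lemma gauss_noise_change_of_mean:
  assumes F: "F \<in> borel_measurable (borel_vec n)" and \<sigma>: "\<sigma> > 0"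
    and a: "a \<in> carrier_vec n" and b: "b \<in> carrier_vec n"
  shows "(\<integral>\<^sup>+e. F (a + e) \<partial>gauss_noise n \<sigma>)\<^sup>2
           \<le> ennreal (exp (sq_norm_rvec (a - b) / \<sigma>\<^sup>2)) * (\<integral>\<^sup>+e. (F (b + e))\<^sup>2 \<partial>gauss_noise n \<sigma>)"
proof -
  have shifted: "(\<lambda>e. F (t + e)) \<in> borel_measurable (borel_vec n)" if "t \<in> carrier_vec n" for t
    using measurable_compose[OF measurable_vec_translate[OF that] F] by simp
  have eq: "a + vec n x = b + vec n (\<lambda>i\<in>{..<n}. x i + (a $ i - b $ i))" for x
    using a b by (auto simp: vec_eq_iff)
  have "(\<integral>\<^sup>+e. F (a + e) \<partial>gauss_noise n \<sigma>)
      = (\<integral>\<^sup>+x. F (b + vec n (\<lambda>i\<in>{..<n}. x i + (a $ i - b $ i))) \<partial>(\<Pi>\<^sub>M i\<in>{..<n}. normal_measure \<sigma>))"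
    by (subst nn_integral_gauss_noise[OF shifted[OF a]]) (simp only: eq)
  also have "\<dots>\<^sup>2 \<le> ennreal (exp ((\<Sum>i<n. (a $ i - b $ i)\<^sup>2) / \<sigma>\<^sup>2))
      * (\<integral>\<^sup>+x. (F (b + vec n x))\<^sup>2 \<partial>(\<Pi>\<^sub>M i\<in>{..<n}. normal_measure \<sigma>))"
    using measurable_compose[OF measurable_vec_PiM shifted[OF b]]
    by (intro normal_PiM_shift_second_moment[where g="\<lambda>x. F (b + vec n x)"] \<sigma>) auto
  also have "(\<integral>\<^sup>+x. (F (b + vec n x))\<^sup>2 \<partial>(\<Pi>\<^sub>M i\<in>{..<n}. normal_measure \<sigma>))
      = (\<integral>\<^sup>+e. (F (b + e))\<^sup>2 \<partial>gauss_noise n \<sigma>)"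
    using shifted[OF b] by (subst nn_integral_gauss_noise) auto
  also have "(\<Sum>i<n. (a $ i - b $ i)\<^sup>2) = sq_norm_rvec (a - b)"
    using a b by (simp add: sq_norm_rvec_diff)
  finally show ?thesis .
qed

section \<open>A lower bound by testing many means\<close>

text \<open>
  The risk as a function of the mean vector, which is the natural parameter until the design matrix
  enters.
\<close>

definition gauss_risk :: "nat \<Rightarrow> real \<Rightarrow> (real vec \<Rightarrow> real vec) \<Rightarrow> real vec \<Rightarrow> ennreal" where
  "gauss_risk n \<sigma> d t = (\<integral>\<^sup>+e. ennreal (sq_norm_rvec (d (t + e) - t)) \<partial>gauss_noise n \<sigma>)"

lemma hit_probability_of_small_risk:
  assumes d: "d \<in> estimators n" and \<sigma>: "\<sigma> > 0" and t: "t \<in> carrier_vec n" and s: "s > 0"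
    and small: "gauss_risk n \<sigma> d t \<le> ennreal (s / 8)"
  shows "measure (gauss_noise n \<sigma>) {e \<in> carrier_vec n. sq_norm_rvec (d (t + e) - t) < s} \<ge> 7 / 8"
proof -
  interpret prob_space "gauss_noise n \<sigma>" by (rule prob_space_gauss_noise[OF \<sigma>])
  let ?f = "\<lambda>e. sq_norm_rvec (d (t + e) - t)"
  have "d \<in> borel_vec n \<rightarrow>\<^sub>M borel_vec n" using d by (simp add: estimators_def)
  then have f: "?f \<in> borel_measurable (borel_vec n)"
    using measurable_compose[OF measurable_vec_translate[OF t] measurable_sq_norm_dist[OF _ t]] by simp
  then have [measurable]: "?f \<in> borel_measurable (gauss_noise n \<sigma>)"
    by (simp cong: measurable_cong_sets)
  have "emeasure (gauss_noise n \<sigma>) {e \<in> space (gauss_noise n \<sigma>). 1 \<le> ennreal (1 / s) * ennreal (?f e)}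
      \<le> ennreal (1 / s) * (\<integral>\<^sup>+e. ennreal (?f e) * indicator (space (gauss_noise n \<sigma>)) e \<partial>gauss_noise n \<sigma>)"
    by (rule nn_integral_Markov_inequality) measurable
  also have "(\<integral>\<^sup>+e. ennreal (?f e) * indicator (space (gauss_noise n \<sigma>)) e \<partial>gauss_noise n \<sigma>)
      = gauss_risk n \<sigma> d t"
    unfolding gauss_risk_def by (intro nn_integral_cong) auto
  also have "ennreal (1 / s) * gauss_risk n \<sigma> d t \<le> ennreal (1 / s) * ennreal (s / 8)"
    by (intro mult_left_mono small) auto
  also have "\<dots> = ennreal (1 / 8)"
    using s by (subst ennreal_mult[symmetric]) auto
  also have "{e \<in> space (gauss_noise n \<sigma>). 1 \<le> ennreal (1 / s) * ennreal (?f e)}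
      = space (gauss_noise n \<sigma>) - {e \<in> space (gauss_noise n \<sigma>). ?f e < s}"
    using s by (auto simp: ennreal_mult[symmetric] field_simps not_less simp flip: ennreal_1)
  finally have "prob (space (gauss_noise n \<sigma>) - {e \<in> space (gauss_noise n \<sigma>). ?f e < s}) \<le> 1 / 8"
    by (simp add: emeasure_eq_measure)
  then have "1 - prob {e \<in> space (gauss_noise n \<sigma>). ?f e < s} \<le> 1 / 8"
    using borel_measurable_less[OF f borel_measurable_const[of s]] by (subst (asm) prob_compl) auto
  then show ?thesis by simp
qed

text \<open>
  A variant of Fano's inequality without entropies. If all risks were small, then under each mean
  \<open>\<theta> i\<close> the event \<open>hit i\<close> that the estimate is close to \<open>\<theta> i\<close> would have probability at least
  \<open>7 / 8\<close>, and the change of mean would give it probability of order at least \<open>sqrt (N / K)\<close>, with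
  \<open>K = card I\<close>, under the common mean \<open>\<theta>0\<close>. But the estimate is never close to more than \<open>N\<close> of the
  \<open>\<theta> i\<close>, so these probabilities under \<open>\<theta>0\<close> have a sum of at most \<open>N\<close>, which is impossible for
  \<open>K \<ge> 2 * N\<close>. Admitting \<open>N > 1\<close> covers families that are not separated, such as a full cube.
\<close>

lemma multiple_hypotheses_risk_lower_bound:
  fixes \<theta> :: "'i \<Rightarrow> real vec"
  assumes fin: "finite I" and \<theta>: "\<And>i. i \<in> I \<Longrightarrow> \<theta> i \<in> carrier_vec n" and \<theta>0: "\<theta>0 \<in> carrier_vec n"
    and \<sigma>: "\<sigma> > 0" and s: "s > 0" and N: "N > 0"
    and few: "\<And>x. x \<in> carrier_vec n \<Longrightarrow> real (card {i \<in> I. sq_norm_rvec (x - \<theta> i) < s}) \<le> N"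
    and many: "2 * N \<le> real (card I)"
    and near: "\<And>i. i \<in> I \<Longrightarrow> sq_norm_rvec (\<theta> i - \<theta>0) \<le> \<sigma>\<^sup>2 / 2 * ln (real (card I) / N)"
    and d: "d \<in> estimators n"
  shows "\<exists>i\<in>I. gauss_risk n \<sigma> d (\<theta> i) \<ge> ennreal (s / 8)"
proof (rule ccontr)
  assume "\<not> ?thesis"
  then have small: "gauss_risk n \<sigma> d (\<theta> i) \<le> ennreal (s / 8)" if "i \<in> I" for i
    using that by force
  interpret prob_space "gauss_noise n \<sigma>" by (rule prob_space_gauss_noise[OF \<sigma>])
  let ?G = "gauss_noise n \<sigma>"
  define K where "K = real (card I)"
  have K: "K > 0" and KN: "K / N \<ge> 2" using many N by (auto simp: K_def field_simps)
  define hit where "hit i = {y \<in> carrier_vec n. sq_norm_rvec (d y - \<theta> i) < s}" for i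
  have dm: "d \<in> borel_vec n \<rightarrow>\<^sub>M borel_vec n" using d by (simp add: estimators_def)
  have hit[measurable]: "hit i \<in> sets (borel_vec n)" if "i \<in> I" for i
    using measurable_sq_norm_dist[OF dm \<theta>[OF that], THEN borel_measurable_less, of "\<lambda>_. s"]
    by (simp add: hit_def)
  have pull: "{e \<in> carrier_vec n. t + e \<in> hit i} \<in> sets ?G" if "i \<in> I" "t \<in> carrier_vec n" for i t
    using measurable_sets[OF measurable_vec_translate[OF that(2)] hit[OF that(1)]]
    by (simp add: vimage_def Int_def conj_commute)
  define q where "q i = prob {e \<in> carrier_vec n. \<theta>0 + e \<in> hit i}" for i
  have q_lower: "49 / 64 \<le> sqrt (K / N) * q i" if i: "i \<in> I" for i
  proof -
    let ?p = "prob {e \<in> carrier_vec n. \<theta> i + e \<in> hit i}"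
    have "{e \<in> carrier_vec n. \<theta> i + e \<in> hit i} = {e \<in> carrier_vec n. sq_norm_rvec (d (\<theta> i + e) - \<theta> i) < s}"
      using \<theta>[OF i] by (auto simp: hit_def)
    then have p: "7 / 8 \<le> ?p"
      using hit_probability_of_small_risk[OF d \<sigma> \<theta>[OF i] s small[OF i]] by simp
    have int: "(\<integral>\<^sup>+e. indicator (hit i) (t + e) \<partial>?G) = ennreal (prob {e \<in> carrier_vec n. t + e \<in> hit i})"
      if "t \<in> carrier_vec n" for t
    proof -
      have "(\<integral>\<^sup>+e. indicator (hit i) (t + e) \<partial>?G) = (\<integral>\<^sup>+e. indicator {e \<in> carrier_vec n. t + e \<in> hit i} e \<partial>?G)"
        by (intro nn_integral_cong) (auto simp: indicator_def)
      then show ?thesis using pull[OF i that] by (simp add: emeasure_eq_measure)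
    qed
    have sq: "(indicator (hit i) x :: ennreal)\<^sup>2 = indicator (hit i) x" for x
      by (simp add: indicator_def)
    have "ennreal (?p\<^sup>2) \<le> ennreal (exp (sq_norm_rvec (\<theta> i - \<theta>0) / \<sigma>\<^sup>2)) * ennreal (q i)"
      using gauss_noise_change_of_mean[OF borel_measurable_indicator[OF hit[OF i]] \<sigma> \<theta>[OF i] \<theta>0]
      by (simp add: sq int \<theta> \<theta>0 i q_def ennreal_power)
    then have "?p\<^sup>2 \<le> exp (sq_norm_rvec (\<theta> i - \<theta>0) / \<sigma>\<^sup>2) * q i"
      by (simp add: q_def flip: ennreal_mult)
    also have "\<dots> \<le> exp (ln (K / N) / 2) * q i"
      using near[OF i] \<sigma> by (intro mult_right_mono) (auto simp: q_def K_def field_simps)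
    also have "exp (ln (K / N) / 2) = sqrt (K / N)"
      using K N by (simp add: ln_sqrt[symmetric])
    finally have "?p\<^sup>2 \<le> sqrt (K / N) * q i" .
    moreover have "(7 / 8)\<^sup>2 \<le> ?p\<^sup>2" using p by (intro power_mono) auto
    ultimately show ?thesis by (simp add: power2_eq_square)
  qed
  have "ennreal (\<Sum>i\<in>I. q i) = (\<Sum>i\<in>I. \<integral>\<^sup>+e. indicator {e \<in> carrier_vec n. \<theta>0 + e \<in> hit i} e \<partial>?G)"
    using pull[OF _ \<theta>0] by (subst sum_ennreal[symmetric]) (auto simp: q_def emeasure_eq_measure)
  also have "\<dots> = (\<integral>\<^sup>+e. (\<Sum>i\<in>I. indicator {e \<in> carrier_vec n. \<theta>0 + e \<in> hit i} e) \<partial>?G)"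
    using pull[OF _ \<theta>0] by (intro nn_integral_sum[symmetric]) auto
  also have "\<dots> \<le> (\<integral>\<^sup>+e. ennreal N \<partial>?G)"
  proof (rule nn_integral_mono)
    fix e assume e: "e \<in> space ?G"
    then have "(\<Sum>i\<in>I. indicator {e \<in> carrier_vec n. \<theta>0 + e \<in> hit i} e :: ennreal)
        = of_nat (card {i \<in> I. sq_norm_rvec (d (\<theta>0 + e) - \<theta> i) < s})"
      (is "?lhs = _")
    proof -
      have "?lhs = (\<Sum>i\<in>I. if sq_norm_rvec (d (\<theta>0 + e) - \<theta> i) < s then 1 else 0)"
        using \<theta>0 e by (intro sum.cong) (auto simp: hit_def indicator_def)
      then show ?thesis using fin by (simp flip: sum.inter_filter)
    qed
    also have "\<dots> = ennreal (real (card {i \<in> I. sq_norm_rvec (d (\<theta>0 + e) - \<theta> i) < s}))"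
      by (simp add: ennreal_of_nat_eq_real_of_nat)
    also have "\<dots> \<le> ennreal N"
      using few[of "d (\<theta>0 + e)"] measurable_space[OF dm, of "\<theta>0 + e"] \<theta>0 e by (intro ennreal_leI) auto
    finally show "(\<Sum>i\<in>I. indicator {e \<in> carrier_vec n. \<theta>0 + e \<in> hit i} e) \<le> ennreal N" .
  qed
  also have "\<dots> = ennreal N" using emeasure_space_1 by simp
  finally have q_sum: "(\<Sum>i\<in>I. q i) \<le> N" using N by simp
  have "K * (49 / 64) = (\<Sum>i\<in>I. 49 / 64)" by (simp add: K_def)
  also have "\<dots> \<le> sqrt (K / N) * (\<Sum>i\<in>I. q i)"
    unfolding sum_distrib_left by (intro sum_mono q_lower)
  also have "\<dots> \<le> sqrt (K / N) * N" using q_sum K N by (intro mult_left_mono) auto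
  finally have "(K / N) * (49 / 64) \<le> sqrt (K / N)" using N by (simp add: field_simps)
  then have "sqrt (K / N) * (sqrt (K / N) * (49 / 64)) \<le> sqrt (K / N) * 1"
    using K N by (simp flip: mult.assoc real_sqrt_mult)
  then have "sqrt (K / N) \<le> 64 / 49" using K N by (simp add: field_simps)
  then have "(sqrt (K / N))\<^sup>2 \<le> (64 / 49)\<^sup>2" using K N by (intro power_mono) auto
  also have "(sqrt (K / N))\<^sup>2 = K / N" using K N by simp
  \<comment> \<open>The probability \<open>7 / 8\<close> is chosen so that its fourth power exceeds \<open>1 / 2\<close>.\<close>
  also have "(64 / 49 :: real)\<^sup>2 < 2" by (simp add: power2_eq_square)
  finally show False using KN by simp
qed

section \<open>Sparse eigenvalues\<close>

text \<open>
  The Frobenius norm bounds the operator norm. Only finiteness of the bound matters: it makes the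
  supremum that defines \<open>phi_max\<close> meaningful.
\<close>

lemma sq_norm_mult_mat_vec_le:
  assumes b: "b \<in> carrier_vec (dim_col X)"
  shows "sq_norm_rvec (X *\<^sub>v b)
           \<le> (\<Sum>i<dim_row X. \<Sum>j<dim_col X. (X $$ (i, j))\<^sup>2) * sq_norm_rvec b"
proof -
  have "X *\<^sub>v b \<in> carrier_vec (dim_row X)" by (rule carrier_vecI) simp
  then have "sq_norm_rvec (X *\<^sub>v b) = (\<Sum>i<dim_row X. (\<Sum>j<dim_col X. X $$ (i, j) * b $ j)\<^sup>2)"
    using b by (subst sq_norm_rvec_sum[of _ "dim_row X"])
      (auto simp: scalar_prod_def lessThan_atLeast0 intro!: sum.cong)
  also have "\<dots> \<le> (\<Sum>i<dim_row X. (\<Sum>j<dim_col X. (X $$ (i, j))\<^sup>2) * (\<Sum>j<dim_col X. (b $ j)\<^sup>2))"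
    by (intro sum_mono Cauchy_Schwarz_ineq_sum)
  finally show ?thesis
    by (simp only: sq_norm_rvec_sum[OF b] sum_distrib_right)
qed

lemma sq_norm_rvec_eq_0_iff_supp: "sq_norm_rvec b = 0 \<longleftrightarrow> supp_vec b = {}"
  by (subst sq_norm_rvec_sum[of _ "dim_vec b"])
     (auto simp: supp_vec_def sum_nonneg_eq_0_iff)

lemma finite_supp_vec [simp]: "finite (supp_vec b)"
  by (simp add: supp_vec_def)

lemma bdd_sparse_rayleigh:
  shows "bdd_below (sparse_rayleigh X k)" "bdd_above (sparse_rayleigh X k)"
proof -
  show "bdd_below (sparse_rayleigh X k)"
    by (rule bdd_belowI[of _ 0]) (auto simp: sparse_rayleigh_def)
  define B where "B = (\<Sum>i<dim_row X. \<Sum>j<dim_col X. (X $$ (i, j))\<^sup>2)"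
  have "sq_norm_rvec (X *\<^sub>v b) / sq_norm_rvec b \<le> B"
    if "b \<in> carrier_vec (dim_col X)" "1 \<le> card (supp_vec b)" for b
  proof -
    have "sq_norm_rvec b \<noteq> 0" using that(2) by (auto simp: sq_norm_rvec_eq_0_iff_supp)
    then have "sq_norm_rvec b > 0" using sq_norm_rvec_nonneg[of b] by linarith
    then show ?thesis
      using sq_norm_mult_mat_vec_le[OF that(1)]
      by (simp add: B_def divide_le_eq)
  qed
  then show "bdd_above (sparse_rayleigh X k)"
    by (intro bdd_aboveI[of _ B]) (auto simp: sparse_rayleigh_def)
qed

lemma sparse_eigenvalue_bounds:
  assumes b: "b \<in> carrier_vec (dim_col X)" and k: "card (supp_vec b) \<le> k"
  shows "phi_min X k * sq_norm_rvec b \<le> sq_norm_rvec (X *\<^sub>v b)"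
    and "sq_norm_rvec (X *\<^sub>v b) \<le> phi_max X k * sq_norm_rvec b"
proof -
  have "phi_min X k * sq_norm_rvec b \<le> sq_norm_rvec (X *\<^sub>v b)
      \<and> sq_norm_rvec (X *\<^sub>v b) \<le> phi_max X k * sq_norm_rvec b"
  proof (cases "supp_vec b = {}")
    case True
    then have "sq_norm_rvec b = 0" by (simp add: sq_norm_rvec_eq_0_iff_supp)
    then show ?thesis
      using sq_norm_mult_mat_vec_le[OF b] sq_norm_rvec_nonneg[of "X *\<^sub>v b"] by simp
  next
    case False
    then have pos: "sq_norm_rvec b > 0"
      using sq_norm_rvec_nonneg[of b] sq_norm_rvec_eq_0_iff_supp[of b] by linarith
    have "1 \<le> card (supp_vec b)"
      using False by (simp add: Suc_le_eq card_gt_0_iff)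
    then have "sq_norm_rvec (X *\<^sub>v b) / sq_norm_rvec b \<in> sparse_rayleigh X k"
      using b k unfolding sparse_rayleigh_def by blast
    then have "phi_min X k \<le> sq_norm_rvec (X *\<^sub>v b) / sq_norm_rvec b"
      "sq_norm_rvec (X *\<^sub>v b) / sq_norm_rvec b \<le> phi_max X k"
      unfolding phi_min_def phi_max_def
      by (auto intro: cInf_lower cSup_upper bdd_sparse_rayleigh)
    then show ?thesis using pos by (simp add: field_simps)
  qed
  then show "phi_min X k * sq_norm_rvec b \<le> sq_norm_rvec (X *\<^sub>v b)"
    and "sq_norm_rvec (X *\<^sub>v b) \<le> phi_max X k * sq_norm_rvec b" by auto
qed

lemma phi_nonneg:
  assumes "dim_col X \<ge> 1" "k \<ge> 1"
  shows "phi_min X k \<ge> 0" "phi_max X k \<ge> 0"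
proof -
  have "supp_vec (unit_vec (dim_col X) 0 :: real vec) = {0}"
    using assms by (auto simp: supp_vec_def split: if_splits)
  then have ne: "sq_norm_rvec (X *\<^sub>v unit_vec (dim_col X) 0) / sq_norm_rvec (unit_vec (dim_col X) 0)
      \<in> sparse_rayleigh X k"
    unfolding sparse_rayleigh_def using assms(2)
    by (intro CollectI exI[of _ "unit_vec (dim_col X) 0"]) auto
  then show "phi_min X k \<ge> 0"
    unfolding phi_min_def by (intro cInf_greatest) (auto simp: sparse_rayleigh_def)
  show "phi_max X k \<ge> 0"
    unfolding phi_max_def by (rule cSup_upper2[OF ne]) (auto intro: bdd_sparse_rayleigh)
qed

section \<open>From families of sets to minimax risk\<close>

text \<open>
  The set \<open>U\<close> is the part that the members of a family share: with \<open>U = {}\<close> the support is \<open>S\<close>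
  itself, and with \<open>S \<subseteq> U\<close> the vector takes the nonzero values \<open>a\<close> and \<open>2 * a\<close> on the support \<open>U\<close>, so
  that a full cube of signals lies inside a single model. In both cases differences depend on the
  sets \<open>S\<close> alone.
\<close>

definition cube_vec :: "nat \<Rightarrow> real \<Rightarrow> nat set \<Rightarrow> nat set \<Rightarrow> real vec" where
  "cube_vec p a U S = vec p (\<lambda>j. a * (of_bool (j \<in> U) + of_bool (j \<in> S)))"

lemma cube_vec_carrier [simp]: "cube_vec p a U S \<in> carrier_vec p"
  by (simp add: cube_vec_def)

lemma supp_cube_vec:
  assumes "a \<noteq> 0" "U \<subseteq> {..<p}" "S \<subseteq> {..<p}"
  shows "supp_vec (cube_vec p a U S) = U \<union> S"
  using assms by (auto simp: supp_vec_def cube_vec_def subset_eq of_bool_def split: if_splits)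

lemma cube_vec_diff:
  assumes "S \<subseteq> {..<p}" "S' \<subseteq> {..<p}"
  shows "card (supp_vec (cube_vec p a U S - cube_vec p a U S')) \<le> card (sym_diff S S')"
    and "sq_norm_rvec (cube_vec p a U S - cube_vec p a U S') = a\<^sup>2 * real (card (sym_diff S S'))"
proof -
  have fin: "finite (sym_diff S S')" using assms by (auto intro: finite_subset)
  show "card (supp_vec (cube_vec p a U S - cube_vec p a U S')) \<le> card (sym_diff S S')"
    by (rule card_mono[OF fin]) (auto simp: supp_vec_def cube_vec_def split: if_splits)
  have "sq_norm_rvec (cube_vec p a U S - cube_vec p a U S')
      = (\<Sum>j<p. if j \<in> sym_diff S S' then a\<^sup>2 else 0)"
    by (subst sq_norm_rvec_diff[of _ p])
       (auto simp: cube_vec_def algebra_simps intro!: sum.cong)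
  also have "\<dots> = (\<Sum>j\<in>{..<p} \<inter> sym_diff S S'. a\<^sup>2)"
    by (subst sum.inter_restrict) auto
  also have "{..<p} \<inter> sym_diff S S' = sym_diff S S'" using assms by auto
  finally show "sq_norm_rvec (cube_vec p a U S - cube_vec p a U S') = a\<^sup>2 * real (card (sym_diff S S'))"
    by (simp add: mult.commute)
qed

text \<open>
  Up to the sparse eigenvalues, the geometry of the mean vectors is the Hamming geometry of the sets.
\<close>

lemma cube_mean_dist:
  assumes X: "X \<in> carrier_mat n p" and S: "S \<subseteq> {..<p}" "S' \<subseteq> {..<p}" and k: "card (sym_diff S S') \<le> k"
  shows "phi_min X k * (a\<^sup>2 * real (card (sym_diff S S')))
           \<le> sq_norm_rvec (X *\<^sub>v cube_vec p a U S - X *\<^sub>v cube_vec p a U S')"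
    and "sq_norm_rvec (X *\<^sub>v cube_vec p a U S - X *\<^sub>v cube_vec p a U S')
           \<le> phi_max X k * (a\<^sup>2 * real (card (sym_diff S S')))"
proof -
  let ?b = "cube_vec p a U S - cube_vec p a U S'"
  have "?b \<in> carrier_vec (dim_col X)" "card (supp_vec ?b) \<le> k"
    using X cube_vec_diff(1)[OF S, of a U] k by auto
  note bounds = sparse_eigenvalue_bounds[OF this]
  have "X *\<^sub>v ?b = X *\<^sub>v cube_vec p a U S - X *\<^sub>v cube_vec p a U S'"
    by (rule mult_minus_distrib_mat_vec[OF X]) auto
  with bounds show "phi_min X k * (a\<^sup>2 * real (card (sym_diff S S')))
      \<le> sq_norm_rvec (X *\<^sub>v cube_vec p a U S - X *\<^sub>v cube_vec p a U S')"
    "sq_norm_rvec (X *\<^sub>v cube_vec p a U S - X *\<^sub>v cube_vec p a U S')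
      \<le> phi_max X k * (a\<^sup>2 * real (card (sym_diff S S')))"
    by (simp_all add: cube_vec_diff(2)[OF S])
qed

text \<open>
  The reduction of the statistical problem to combinatorics: a family \<open>F\<close> of sets gives a good bound
  if it lies in a Hamming ball of radius \<open>R\<close> while smaller Hamming balls of radius \<open>D\<close> contain only a
  small part, of size \<open>N\<close>, of it. Only the ratio \<open>D / R\<close> and the local entropy \<open>ln (card F / N)\<close>
  enter. The centre \<open>S0\<close> of the large ball gives the reference mean.
\<close>

lemma minimax_risk_ge_of_set_family:
  assumes X: "X \<in> carrier_mat n p" and p: "p \<ge> 1" and k: "k \<ge> 1" and \<sigma>: "\<sigma> > 0"
    and F: "finite F" "\<And>S. S \<in> F \<Longrightarrow> S \<subseteq> {..<p}" and U: "U \<subseteq> {..<p}" and S0: "S0 \<subseteq> {..<p}"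
    and adm: "\<And>S. S \<in> F \<Longrightarrow> U \<union> S \<in> models_up_to A p0"
    and pair: "\<And>S S'. S \<in> F \<Longrightarrow> S' \<in> F \<Longrightarrow> card (sym_diff S S') \<le> k"
    and near: "\<And>S. S \<in> F \<Longrightarrow> card (sym_diff S S0) \<le> k" "\<And>S. S \<in> F \<Longrightarrow> real (card (sym_diff S S0)) \<le> R"
    and few: "\<And>S'. S' \<in> F \<Longrightarrow> real (card {S \<in> F. real (card (sym_diff S S')) < D}) \<le> N"
    and many: "2 * N \<le> real (card F)" and R: "R > 0" and D: "D > 0" and N: "N > 0"
  shows "minimax_risk X \<sigma> A p0 \<ge> ennreal (\<sigma>\<^sup>2 * tau X k * (D / R) * ln (real (card F) / N) / 64)"
proof (cases "tau X k > 0")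
  case False
  have "ln (real (card F) / N) \<ge> 0" using many N by (intro ln_ge_zero) (simp add: field_simps)
  then have "\<sigma>\<^sup>2 * tau X k * (D / R) * ln (real (card F) / N) / 64 \<le> 0"
    using False R D by (intro divide_nonpos_pos mult_nonpos_nonneg mult_nonneg_nonpos) auto
  then show ?thesis by (simp add: ennreal_neg)
next
  case True
  have dims: "dim_row X = n" "dim_col X = p" using X by auto
  have \<phi>: "phi_min X k > 0" "phi_max X k > 0"
    using phi_nonneg[of X k] p k True by (auto simp: tau_def dims zero_less_divide_iff)
  define L where "L = ln (real (card F) / N)"
  have L: "L > 0" unfolding L_def using many N by (intro ln_gt_zero) (simp add: field_simps)
  \<comment> \<open>The largest amplitude for which all means are still close enough to the reference mean
    for the testing bound.\<close>
  define a where "a = sqrt (\<sigma>\<^sup>2 * L / (2 * R * phi_max X k))"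
  have a2: "a\<^sup>2 = \<sigma>\<^sup>2 * L / (2 * R * phi_max X k)" and a: "a > 0"
    using \<sigma> L R \<phi> by (auto simp: a_def)
  define \<theta> where "\<theta> S = X *\<^sub>v cube_vec p a U S" for S
  have \<theta>: "\<theta> S \<in> carrier_vec n" for S
    unfolding \<theta>_def by (rule mult_mat_vec_carrier[OF X]) simp
  \<comment> \<open>Means at Hamming distance at least \<open>D\<close> are at squared distance at least \<open>4 * s\<close>.\<close>
  define s where "s = phi_min X k * a\<^sup>2 * D / 4"
  have s: "s > 0" using \<phi> a D by (simp add: s_def)
  have few_means: "real (card {S \<in> F. sq_norm_rvec (x - \<theta> S) < s}) \<le> N" if x: "x \<in> carrier_vec n" for x
  proof (cases "\<exists>S'\<in>F. sq_norm_rvec (x - \<theta> S') < s")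
    case True
    then obtain S' where S': "S' \<in> F" "sq_norm_rvec (x - \<theta> S') < s" by blast
    have "real (card (sym_diff S S')) < D" if S: "S \<in> F" "sq_norm_rvec (x - \<theta> S) < s" for S
    proof -
      have "phi_min X k * (a\<^sup>2 * real (card (sym_diff S S'))) \<le> sq_norm_rvec (\<theta> S - \<theta> S')"
        unfolding \<theta>_def by (intro cube_mean_dist(1)[OF X] F pair S S')
      also have "\<dots> \<le> 2 * sq_norm_rvec (x - \<theta> S) + 2 * sq_norm_rvec (x - \<theta> S')"
        by (rule sq_norm_rvec_dist_triangle[OF \<theta> \<theta> x])
      also have "\<dots> < 4 * s" using S S' by simp
      also have "\<dots> = phi_min X k * (a\<^sup>2 * D)" by (simp add: s_def)
      finally show ?thesis using \<phi> a by simp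
    qed
    then have "card {S \<in> F. sq_norm_rvec (x - \<theta> S) < s} \<le> card {S \<in> F. real (card (sym_diff S S')) < D}"
      using F(1) by (intro card_mono) auto
    with few[OF S'(1)] show ?thesis by linarith
  next
    case False
    then have "{S \<in> F. sq_norm_rvec (x - \<theta> S) < s} = {}" by blast
    then show ?thesis using N by (metis card.empty of_nat_0 less_imp_le)
  qed
  have close: "sq_norm_rvec (\<theta> S - \<theta> S0) \<le> \<sigma>\<^sup>2 / 2 * ln (real (card F) / N)" if "S \<in> F" for S
  proof -
    have "sq_norm_rvec (\<theta> S - \<theta> S0) \<le> phi_max X k * (a\<^sup>2 * real (card (sym_diff S S0)))"
      unfolding \<theta>_def by (intro cube_mean_dist(2)[OF X] F S0 near that)
    also have "\<dots> \<le> phi_max X k * (a\<^sup>2 * R)"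
      using near(2)[OF that] \<phi> by (intro mult_left_mono) auto
    also have "\<dots> = \<sigma>\<^sup>2 / 2 * L" using R \<phi> by (simp add: a2 field_simps)
    finally show ?thesis by (simp add: L_def)
  qed
  have s8: "s / 8 = \<sigma>\<^sup>2 * tau X k * (D / R) * ln (real (card F) / N) / 64"
    using \<phi> R by (simp add: s_def a2 tau_def L_def field_simps)
  show ?thesis
    unfolding minimax_risk_def
  proof (rule INF_greatest)
    fix d assume "d \<in> estimators (dim_row X)"
    then have d: "d \<in> estimators n" by (simp add: dims)
    obtain S where S: "S \<in> F" "gauss_risk n \<sigma> d (\<theta> S) \<ge> ennreal (s / 8)"
      using multiple_hypotheses_risk_lower_bound[OF F(1) \<theta> \<theta> \<sigma> s N few_means many close d] by blast
    have "supp_vec (cube_vec p a U S) \<in> models_up_to A p0"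
      using adm[OF S(1)] a supp_cube_vec[of a U p S] U F(2)[OF S(1)] by simp
    then have member: "cube_vec p a U S \<in> {b \<in> carrier_vec (dim_col X). supp_vec b \<in> models_up_to A p0}"
      by (simp add: dims)
    have "ennreal (s / 8) \<le> risk X \<sigma> d (cube_vec p a U S)"
      using S(2) by (simp add: risk_def gauss_risk_def \<theta>_def dims)
    also have "\<dots> \<le> (SUP b\<in>{b \<in> carrier_vec (dim_col X). supp_vec b \<in> models_up_to A p0}. risk X \<sigma> d b)"
      by (rule SUP_upper[OF member])
    finally show "ennreal (\<sigma>\<^sup>2 * tau X k * (D / R) * ln (real (card F) / N) / 64)
        \<le> (SUP b\<in>{b \<in> carrier_vec (dim_col X). supp_vec b \<in> models_up_to A p0}. risk X \<sigma> d b)"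
      by (simp only: s8)
  qed
qed

section \<open>The dimension term\<close>

text \<open>
  Chernoff's method: each subset \<open>T\<close> with fewer than \<open>D\<close> elements is counted with the weight
  \<open>2 powr D * (1 / 2) ^ card T \<ge> 1\<close>, and the weights of all subsets are summed by the binomial
  theorem.
\<close>

lemma card_small_subsets_le:
  assumes "finite M"
  shows "real (card {T \<in> Pow M. real (card T) < D}) \<le> 2 powr D * (3 / 2) ^ card M"
proof -
  have "real (card {T \<in> Pow M. real (card T) < D}) = (\<Sum>T\<in>{T \<in> Pow M. real (card T) < D}. 1)"
    by simp
  also have "\<dots> \<le> (\<Sum>T\<in>{T \<in> Pow M. real (card T) < D}. 2 powr D * (1 / 2) ^ card T)"
  proof (rule sum_mono)
    fix T assume "T \<in> {T \<in> Pow M. real (card T) < D}"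
    then have "2 ^ card T \<le> (2 :: real) powr D" by (simp flip: powr_realpow)
    then show "1 \<le> 2 powr D * (1 / 2 :: real) ^ card T" by (simp add: power_divide field_simps)
  qed
  also have "\<dots> \<le> (\<Sum>T\<in>Pow M. 2 powr D * (1 / 2) ^ card T)"
    using assms(1) by (intro sum_mono2) auto
  also have "\<dots> = 2 powr D * (\<Sum>T\<in>Pow M. (\<Prod>x\<in>T. 1 / 2) * (\<Prod>x\<in>M - T. 1))"
    by (simp add: sum_distrib_left)
  also have "\<dots> = 2 powr D * (\<Prod>x\<in>M. 1 / 2 + 1)"
    by (simp only: prod_add[OF assms(1)])
  finally show ?thesis by simp
qed

text \<open>
  A Hamming ball of radius \<open>q / 8\<close> in the cube of dimension \<open>q\<close> is exponentially small. For \<open>q \<ge> 8\<close>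
  this is the Chernoff bound; for \<open>q < 8\<close>, where that bound is too weak to give \<open>2 * N \<le> 2 ^ q\<close> in
  general, such a ball is a single point.
\<close>

lemma hamming_balls_of_radius_eighth_are_small:
  assumes M: "finite M" "card M = q" and q: "q \<ge> 1"
  obtains N :: real where "N > 0" "2 * N \<le> 2 ^ q" "real q / 8 \<le> ln (2 ^ q / N)"
    "\<And>S'. S' \<subseteq> M \<Longrightarrow> real (card {S \<in> Pow M. real (card (sym_diff S S')) < real q / 8}) \<le> N"
proof -
  have centre: "card {S \<in> Pow M. real (card (sym_diff S S')) < real q / 8}
      \<le> card {T \<in> Pow M. real (card T) < real q / 8}" if "S' \<subseteq> M" for S'
    using M(1) that by (intro card_inj_on_le[where f="\<lambda>S. sym_diff S S'"]) (auto simp: inj_on_def)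
  show thesis
  proof (cases "q < 8")
    case True
    have "real (card {S \<in> Pow M. real (card (sym_diff S S')) < real q / 8}) \<le> 1" if S': "S' \<subseteq> M" for S'
    proof -
      have "T = {}" if "T \<in> Pow M" "real (card T) < real q / 8" for T
      proof -
        have "card T = 0" using that True by linarith
        then show ?thesis using that M(1) finite_subset by (auto simp: card_eq_0_iff)
      qed
      then have "{T \<in> Pow M. real (card T) < real q / 8} \<subseteq> {{}}" by blast
      then have "card {T \<in> Pow M. real (card T) < real q / 8} \<le> card {{} :: 'a set}"
        by (intro card_mono) auto
      with centre[OF S'] show ?thesis by simp
    qed
    moreover have "(2::real) * 1 \<le> 2 ^ q" using power_increasing[of 1 q "2::real"] q by simp
    moreover have "real q / 8 \<le> real q * ln 2" using ln2_ge_two_thirds q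
      by (simp add: field_simps)
    ultimately show ?thesis by (intro that[of 1]) (auto simp: ln_realpow)
  next
    case False
    define N where "N = 2 powr (real q / 8) * (3 / 2 :: real) ^ q"
    have N: "N > 0" by (simp add: N_def)
    have "exp 1 \<le> (4 / 3 :: real) ^ 8 / 2" using exp_le by (simp add: power_divide)
    then have "1 \<le> ln ((4 / 3 :: real) ^ 8 / 2)" by (subst ln_ge_iff) auto
    also have "\<dots> = 8 * ln (4 / 3) - ln 2" by (subst ln_div) (auto simp: ln_realpow)
    finally have num: "1 / 8 \<le> ln (4 / 3 :: real) - ln 2 / 8" by simp
    have "ln (4 / 3 :: real) = ln 2 - ln (3 / 2)" using ln_div[of 2 "3 / 2 :: real"] by simp
    then have "ln (2 ^ q / N) = real q * (ln (4 / 3) - ln 2 / 8)"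
      unfolding N_def by (simp add: ln_divide_pos ln_mult_pos ln_realpow ln_powr algebra_simps
          del: ln_div)
    then have ln_ge: "real q / 8 \<le> ln (2 ^ q / N)"
      using mult_left_mono[OF num, of "real q"] by simp
    have "ln 2 \<le> real q / 8" using ln_2_less_1 False by simp
    then have "ln 2 \<le> ln (2 ^ q / N)" using ln_ge by linarith
    then have "2 \<le> 2 ^ q / N" using N by simp
    then have "2 * N \<le> 2 ^ q" using N by (simp add: field_simps)
    moreover have "real (card {S \<in> Pow M. real (card (sym_diff S S')) < real q / 8}) \<le> N" if "S' \<subseteq> M" for S'
      using centre[OF that] card_small_subsets_le[OF M(1), of "real q / 8"] M(2)
      by (simp add: N_def)
    ultimately show ?thesis using N ln_ge by (intro that[of N]) auto
  qed
qed

text \<open>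
  One model of size \<open>p0\<close> already contains a cube of signals of dimension \<open>p0\<close>, with values \<open>a\<close> and
  \<open>2 * a\<close> so that no coefficient vanishes. Its small balls are exponentially small, hence the local
  entropy is of order \<open>p0\<close>.
\<close>

lemma minimax_risk_ge_dimension:
  assumes X: "X \<in> carrier_mat n p" and \<sigma>: "\<sigma> > 0" and p0: "p0 \<ge> 1"
    and M: "M \<in> A" "M \<subseteq> {..<p}" "card M = p0"
  shows "minimax_risk X \<sigma> A p0 \<ge> ennreal (\<sigma>\<^sup>2 * tau X p0 * real p0 / 4096)"
proof -
  have fin: "finite M" using M(2) finite_subset by blast
  have p: "p \<ge> 1" using M p0 by (cases p) auto
  obtain N where N: "N > 0" "2 * N \<le> 2 ^ p0" "real p0 / 8 \<le> ln (2 ^ p0 / N)"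
    "\<And>S'. S' \<subseteq> M \<Longrightarrow> real (card {S \<in> Pow M. real (card (sym_diff S S')) < real p0 / 8}) \<le> N"
    using hamming_balls_of_radius_eighth_are_small[OF fin M(3) p0] by blast
  have sd: "card (sym_diff S S') \<le> p0" if "S \<subseteq> M" "S' \<subseteq> M" for S S'
    using card_mono[OF fin, of "sym_diff S S'"] that M(3) by blast
  have "minimax_risk X \<sigma> A p0
      \<ge> ennreal (\<sigma>\<^sup>2 * tau X p0 * ((real p0 / 8) / real p0) * ln (real (card (Pow M)) / N) / 64)"
  proof (rule minimax_risk_ge_of_set_family[OF X p p0 \<sigma>, where U=M and ?S0.0="{}"])
    show "M \<union> S \<in> models_up_to A p0" if "S \<in> Pow M" for S
      using that M by (auto simp: models_up_to_def models_of_size_def Un_absorb2)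
    show "real (card (sym_diff S {})) \<le> real p0" if "S \<in> Pow M" for S
      using sd[of S "{}"] that by simp
    show "card (sym_diff S {}) \<le> p0" if "S \<in> Pow M" for S
      using sd[of S "{}"] that by simp
    show "card (sym_diff S S') \<le> p0" if "S \<in> Pow M" "S' \<in> Pow M" for S S'
      using sd that by auto
    show "real (card {S \<in> Pow M. real (card (sym_diff S S')) < real p0 / 8}) \<le> N" if "S' \<in> Pow M" for S'
      using N(4) that by auto
  qed (use N M fin p0 in \<open>auto simp: card_Pow\<close>)
  moreover have "\<sigma>\<^sup>2 * tau X p0 * real p0 / 4096
      \<le> \<sigma>\<^sup>2 * tau X p0 * ((real p0 / 8) / real p0) * ln (real (card (Pow M)) / N) / 64"
  proof -
    have "tau X p0 \<ge> 0" using phi_nonneg[of X p0] X p p0 by (simp add: tau_def)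
    then have "\<sigma>\<^sup>2 * tau X p0 / 512 * (real p0 / 8) \<le> \<sigma>\<^sup>2 * tau X p0 / 512 * ln (2 ^ p0 / N)"
      by (intro mult_left_mono N(3)) auto
    then show ?thesis using M(3) fin p0 by (simp add: card_Pow)
  qed
  ultimately show ?thesis by (meson ennreal_leI order_trans)
qed

section \<open>The entropy term\<close>

text \<open>
  By maximality, a separated set that cannot be enlarged is also a net.
\<close>

lemma maximal_separated_subset:
  fixes h :: "'a \<Rightarrow> 'a \<Rightarrow> nat"
  assumes "finite S" and sym: "\<And>x y. x \<in> S \<Longrightarrow> y \<in> S \<Longrightarrow> h x y = h y x"
  obtains T where "T \<subseteq> S" "\<And>x y. x \<in> T \<Longrightarrow> y \<in> T \<Longrightarrow> x \<noteq> y \<Longrightarrow> e \<le> h x y"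
    "\<And>x. x \<in> S \<Longrightarrow> x \<in> T \<or> (\<exists>t\<in>T. h x t < e)"
proof -
  define P where "P = {T. T \<subseteq> S \<and> (\<forall>x\<in>T. \<forall>y\<in>T. x \<noteq> y \<longrightarrow> e \<le> h x y)}"
  have "finite P" using assms(1) by (auto simp: P_def intro: finite_subset[of _ "Pow S"])
  moreover have "{} \<in> P" by (simp add: P_def)
  ultimately obtain T where T: "T \<in> P" and max: "\<And>T'. T' \<in> P \<Longrightarrow> T \<subseteq> T' \<Longrightarrow> T = T'"
    using finite_has_maximal[of P] by blast
  have "x \<in> T \<or> (\<exists>t\<in>T. h x t < e)" if x: "x \<in> S" for x
  proof (rule ccontr)
    assume *: "\<not> ?thesis"
    have "e \<le> h t x" if "t \<in> T" for t
      using * that sym[of t x] T x by (auto simp: P_def not_less)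
    then have "insert x T \<in> P" using T x * by (auto simp: P_def not_less)
    from max[OF this] * show False by blast
  qed
  then show thesis using T by (intro that[of T]) (auto simp: P_def)
qed

text \<open>
  All of \<open>S\<close> is within distance \<open>2 ^ Suc l\<close> of \<open>c\<close>, which leaves \<open>Suc l\<close> dyadic scales. At the
  current scale, either a maximal separated subset has the required \<open>B\<close> elements, or the balls
  around its fewer than \<open>B\<close> elements cover \<open>S\<close>, and one of them keeps more than a fraction \<open>1 / B\<close> of
  \<open>S\<close> in half the radius. The budget \<open>B ^ Suc l \<le> card S\<close> cannot be exhausted before the last scale,
  where distinct points are separated anyway. The set \<open>C\<close> only records where the centre lies.
\<close>

lemma local_packing_at_some_scale:
  fixes h :: "'a \<Rightarrow> 'a \<Rightarrow> nat" and B :: real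
  assumes "finite S" and "\<And>x y. x \<in> S \<Longrightarrow> y \<in> S \<Longrightarrow> h x y = h y x"
    and "\<And>x y. x \<in> S \<Longrightarrow> y \<in> S \<Longrightarrow> x \<noteq> y \<Longrightarrow> 1 \<le> h x y"  and "\<And>x. x \<in> S \<Longrightarrow> h x x = 0"
    and "B > 0" and "c \<in> C" and "\<And>x. x \<in> S \<Longrightarrow> h x c < 2 ^ Suc l" and "S \<subseteq> C"
    and "B ^ Suc l \<le> real (card S)"
  shows "\<exists>j c' T. c' \<in> C \<and> T \<subseteq> S \<and> B \<le> real (card T) \<and> (\<forall>t\<in>T. h t c' < 2 ^ Suc j)
           \<and> (\<forall>x\<in>T. \<forall>y\<in>T. x \<noteq> y \<longrightarrow> 2 ^ j \<le> h x y)"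
  using assms
proof (induction l arbitrary: S c)
  case 0
  then show ?case
    by (intro exI[of _ 0] exI[of _ c] exI[of _ S]) auto
next
  case (Suc l)
  note h_sym = Suc.prems(2) and h_pos = Suc.prems(3) and h_self = Suc.prems(4) and B = Suc.prems(5)
  obtain T where T: "T \<subseteq> S" "\<And>x y. x \<in> T \<Longrightarrow> y \<in> T \<Longrightarrow> x \<noteq> y \<Longrightarrow> 2 ^ Suc l \<le> h x y"
    and cover: "\<And>x. x \<in> S \<Longrightarrow> x \<in> T \<or> (\<exists>t\<in>T. h x t < 2 ^ Suc l)"
    using maximal_separated_subset[where h=h and e="2 ^ Suc l", OF Suc.prems(1) h_sym] by blast
  show ?case
  proof (cases "B \<le> real (card T)")
    case True
    with T Suc.prems(6,7) show ?thesis
      by (intro exI[of _ "Suc l"] exI[of _ c] exI[of _ T]) auto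
  next
    case False
    define ball where "ball t = {x \<in> S. h x t < 2 ^ Suc l}" for t
    have finT: "finite T" using T(1) Suc.prems(1) finite_subset by blast
    have "card S > 0" using Suc.prems(9) B zero_less_power[OF B, of "Suc (Suc l)"] by linarith
    then have "S \<noteq> {}" by auto
    then have neT: "T \<noteq> {}" using cover by blast
    have "\<exists>t\<in>T. B ^ Suc l \<le> real (card (ball t))"
    proof (rule ccontr)
      assume "\<not> ?thesis"
      then have small: "real (card (ball t)) < B ^ Suc l" if "t \<in> T" for t using that by force
      have "S \<subseteq> (\<Union>t\<in>T. ball t)"
      proof
        fix x assume x: "x \<in> S"
        from cover[OF x] show "x \<in> (\<Union>t\<in>T. ball t)"
        proof
          assume "x \<in> T"
          moreover have "x \<in> ball x" using x h_self[OF x] by (simp add: ball_def)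
          ultimately show ?thesis by blast
        qed (use x in \<open>auto simp: ball_def\<close>)
      qed
      then have "card S \<le> card (\<Union>t\<in>T. ball t)"
        using Suc.prems(1) finT by (intro card_mono) (auto simp: ball_def)
      also have "\<dots> \<le> (\<Sum>t\<in>T. card (ball t))" by (rule card_UN_le[OF finT])
      finally have "real (card S) \<le> (\<Sum>t\<in>T. real (card (ball t)))"
        by (metis of_nat_le_iff of_nat_sum)
      also have "\<dots> < (\<Sum>t\<in>T. B ^ Suc l)" by (intro sum_strict_mono finT neT small)
      also have "\<dots> = real (card T) * B ^ Suc l" by simp
      also have "\<dots> \<le> B * B ^ Suc l" using False B by (intro mult_right_mono) auto
      finally show False using Suc.prems(9) by simp
    qed
    then obtain t where t: "t \<in> T" "B ^ Suc l \<le> real (card (ball t))" by blast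
    have sub: "ball t \<subseteq> S" by (auto simp: ball_def)
    have "\<exists>j c' T. c' \<in> C \<and> T \<subseteq> ball t \<and> B \<le> real (card T) \<and> (\<forall>t\<in>T. h t c' < 2 ^ Suc j)
           \<and> (\<forall>x\<in>T. \<forall>y\<in>T. x \<noteq> y \<longrightarrow> 2 ^ j \<le> h x y)"
    proof (rule Suc.IH[of "ball t" t])
      show "finite (ball t)" using sub Suc.prems(1) finite_subset by blast
      show "h x t < 2 ^ Suc l" if "x \<in> ball t" for x using that by (simp add: ball_def)
      show "t \<in> C" "ball t \<subseteq> C" using t(1) T(1) Suc.prems(8) sub by auto
      show "h x y = h y x" if "x \<in> ball t" "y \<in> ball t" for x y
        using that sub by (intro h_sym) auto
      show "1 \<le> h x y" if "x \<in> ball t" "y \<in> ball t" "x \<noteq> y" for x y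
        using that sub by (intro h_pos) auto
    qed (use sub h_self B t(2) in auto)
    then obtain j c' T' where T': "c' \<in> C" "T' \<subseteq> ball t" "B \<le> real (card T')"
      "\<forall>t\<in>T'. h t c' < 2 ^ Suc j" "\<forall>x\<in>T'. \<forall>y\<in>T'. x \<noteq> y \<longrightarrow> 2 ^ j \<le> h x y"
      by (elim exE conjE) (rule that)
    show ?thesis
      by (intro exI[of _ j] exI[of _ c'] exI[of _ T'] conjI T' order_trans[OF T'(2) sub])
  qed
qed

lemma card_sym_diff_equal_card:
  assumes "finite S" "finite S'" "card S = card S'"
  shows "card (S - S') = card (S' - S)" "card (sym_diff S S') = 2 * card (S - S')"
proof -
  have "card S = card (S \<inter> S') + card (S - S')" "card S' = card (S' \<inter> S) + card (S' - S)"
    using assms by (metis card_Int_Diff)+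
  then show *: "card (S - S') = card (S' - S)" using assms(3) by (simp add: Int_commute)
  have "card (sym_diff S S') = card (S - S') + card (S' - S)"
    using assms by (intro card_Un_disjoint) auto
  with * show "card (sym_diff S S') = 2 * card (S - S')" by simp
qed

text \<open>
  A family of models of size \<open>p0\<close> need not contain many models at pairwise distance of order \<open>p0\<close>: all
  of them may share \<open>p0 - 1\<close> predictors. What matters is only that the separation is comparable to
  the radius, and of the at most \<open>5 / 2 * max 1 (ln p0)\<close> dyadic scales one carries at least an equal
  share of \<open>ln m\<close>. This is the source of the factor \<open>max 1 (ln p0)\<close>. Supports of differences of two
  signals have up to \<open>2 * p0\<close> elements, whence \<open>tau X (2 * p0)\<close>.
\<close>

lemma minimax_risk_ge_log_card_models:
  assumes X: "X \<in> carrier_mat n p" and \<sigma>: "\<sigma> > 0" and p0: "p0 \<ge> 1"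
    and sub: "\<And>M. M \<in> A \<Longrightarrow> M \<subseteq> {..<p}" and m: "m = card (models_of_size A p0)" "m \<ge> 1"
  shows "minimax_risk X \<sigma> A p0
           \<ge> ennreal (\<sigma>\<^sup>2 * tau X (2 * p0) * (ln (real m) / max 1 (ln (real p0))) / 320)"
proof (cases "m = 1")
  case True
  then show ?thesis by simp
next
  case False
  define S where "S = models_of_size A p0"
  have S: "M \<subseteq> {..<p}" "finite M" "card M = p0" "M \<in> models_up_to A p0" if "M \<in> S" for M
    using that sub finite_subset[OF sub] by (auto simp: S_def models_of_size_def models_up_to_def)
  have finS: "finite S" using S(1) by (auto intro: finite_subset[of _ "Pow {..<p}"])
  have m2: "m \<ge> 2" "card S = m" using False m by (auto simp: S_def)
  have "S \<noteq> {}" using m2 by auto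
  then obtain M0 where M0: "M0 \<in> S" by blast
  have p: "p \<ge> 1" using S[OF M0] p0 by (cases p) auto
  obtain l where l: "2 ^ l \<le> p0" "p0 < 2 ^ Suc l"
    using ex_power_ivl1[of 2 p0] p0 by (metis Suc_eq_plus1 le_refl)
  define B where "B = real m powr (1 / real (Suc l))"
  have B: "B > 1" unfolding B_def using m2 by (intro gr_one_powr) auto
  have BS: "B ^ Suc l = real m"
    unfolding B_def using m2 by (subst powr_realpow[symmetric]) (auto simp: powr_powr)
  have "\<exists>j c T. c \<in> S \<and> T \<subseteq> S \<and> B \<le> real (card T) \<and> (\<forall>t\<in>T. card (t - c) < 2 ^ Suc j)
      \<and> (\<forall>x\<in>T. \<forall>y\<in>T. x \<noteq> y \<longrightarrow> 2 ^ j \<le> card (x - y))"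
  proof (rule local_packing_at_some_scale[where c=M0 and l=l])
    show "card (x - y) = card (y - x)" if "x \<in> S" "y \<in> S" for x y
      using that S by (intro card_sym_diff_equal_card) auto
    show "1 \<le> card (x - y)" if "x \<in> S" "y \<in> S" "x \<noteq> y" for x y
    proof -
      have "\<not> x \<subseteq> y" using that S card_subset_eq[of y x] by auto
      then have "x - y \<noteq> {}" by blast
      then show ?thesis using S(2)[OF that(1)] by (simp add: Suc_le_eq card_gt_0_iff)
    qed
    show "card (x - M0) < 2 ^ Suc l" if "x \<in> S" for x
      using card_mono[of x "x - M0"] S[OF that] l(2) by (auto intro: le_less_trans)
  qed (use finS B BS m2 M0 in auto)
  then obtain j c T where c: "c \<in> S" and T: "T \<subseteq> S" "B \<le> real (card T)"
    and near: "\<forall>t\<in>T. card (t - c) < 2 ^ Suc j"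
    and sep: "\<forall>x\<in>T. \<forall>y\<in>T. x \<noteq> y \<longrightarrow> 2 ^ j \<le> card (x - y)"
    by (elim exE conjE) (rule that)
  have sd: "card (sym_diff x y) = 2 * card (x - y)" "card (sym_diff x y) \<le> 2 * p0"
    if "x \<in> S" "y \<in> S" for x y
  proof -
    show *: "card (sym_diff x y) = 2 * card (x - y)"
      using that S by (intro card_sym_diff_equal_card) auto
    show "card (sym_diff x y) \<le> 2 * p0"
      using * card_mono[of x "x - y"] S[OF that(1)] by auto
  qed
  have cardT: "2 \<le> card T" using T(2) B by linarith
  \<comment> \<open>For sets of equal size the symmetric difference is twice the one-sided difference, which
    doubles both the separation \<open>2 ^ j\<close> and the radius \<open>2 ^ Suc j\<close>.\<close>
  have "minimax_risk X \<sigma> A p0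
      \<ge> ennreal (\<sigma>\<^sup>2 * tau X (2 * p0) * (2 ^ Suc j / 2 ^ Suc (Suc j)) * ln (real (card T) / 1) / 64)"
  proof (rule minimax_risk_ge_of_set_family[OF X p _ \<sigma>, where U="{}" and ?S0.0=c])
    show "finite T" using T(1) finS finite_subset by blast
    show "{} \<union> x \<in> models_up_to A p0" if "x \<in> T" for x using that T S by auto
    show "card (sym_diff x y) \<le> 2 * p0" if "x \<in> T" "y \<in> T" for x y using that T by (intro sd) auto
    show "card (sym_diff x c) \<le> 2 * p0" if "x \<in> T" for x using that T c by (intro sd) auto
    show "real (card (sym_diff x c)) \<le> 2 ^ Suc (Suc j)" if x: "x \<in> T" for x
    proof -
      have "card (sym_diff x c) \<le> 2 ^ Suc (Suc j)"
        using sd(1)[of x c] bspec[OF near x] T c x by auto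
      then have "real (card (sym_diff x c)) \<le> real (2 ^ Suc (Suc j))" by (rule of_nat_mono)
      then show ?thesis by simp
    qed
    show "real (card {x \<in> T. real (card (sym_diff x y)) < 2 ^ Suc j}) \<le> 1" if y: "y \<in> T" for y
    proof -
      have "x = y" if x: "x \<in> T" "real (card (sym_diff x y)) < 2 ^ Suc j" for x
      proof (rule ccontr)
        assume "x \<noteq> y"
        then have "2 ^ j \<le> card (x - y)" using sep x y by blast
        moreover have "card (sym_diff x y) = 2 * card (x - y)" using sd(1) x y T by blast
        ultimately have "2 ^ Suc j \<le> card (sym_diff x y)" by simp
        then have "real (2 ^ Suc j) \<le> real (card (sym_diff x y))" by (rule of_nat_mono)
        then show False using x(2) by simp
      qed
      then have "{x \<in> T. real (card (sym_diff x y)) < 2 ^ Suc j} \<subseteq> {y}" by blast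
      then have "card {x \<in> T. real (card (sym_diff x y)) < 2 ^ Suc j} \<le> card {y}"
        by (intro card_mono) auto
      then show ?thesis by simp
    qed
    show "x \<subseteq> {..<p}" if "x \<in> T" for x using that T(1) S(1) by blast
  qed (use p S(1)[OF c] p0 cardT in auto)
  moreover have "\<sigma>\<^sup>2 * tau X (2 * p0) * (ln (real m) / max 1 (ln (real p0))) / 320
      \<le> \<sigma>\<^sup>2 * tau X (2 * p0) * (2 ^ Suc j / 2 ^ Suc (Suc j)) * ln (real (card T) / 1) / 64"
  proof -
    define L where "L = max 1 (ln (real p0))"
    have L: "L \<ge> 1" "ln (real p0) \<le> L" by (auto simp: L_def)
    have "real (2 ^ l) \<le> real p0" using l(1) by (rule of_nat_mono)
    then have "ln (2 ^ l) \<le> ln (real p0)" using p0 by (subst ln_le_cancel_iff) auto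
    then have "real l * ln 2 \<le> L" using L by (simp add: ln_realpow)
    moreover have "real l * (2 / 3) \<le> real l * ln 2" using ln2_ge_two_thirds by (intro mult_left_mono) auto
    ultimately have scales: "real (Suc l) \<le> 5 / 2 * L" using L by simp
    have "ln B \<le> ln (real (card T))" using B T(2) by simp
    moreover have "ln (real m) = real (Suc l) * ln B" 
      unfolding BS[symmetric] by (rule ln_realpow)
    moreover have "real (Suc l) * ln B \<le> 5 / 2 * L * ln (real (card T))"
      using scales calculation(1) B L by (intro mult_mono) auto
    ultimately have "ln (real m) / L \<le> 5 / 2 * ln (real (card T))" using L by (simp add: divide_le_eq mult_ac)
    moreover have "tau X (2 * p0) \<ge> 0" using phi_nonneg[of X "2 * p0"] X p p0 by (simp add: tau_def)
    ultimately have "\<sigma>\<^sup>2 * tau X (2 * p0) / 320 * (ln (real m) / L)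
        \<le> \<sigma>\<^sup>2 * tau X (2 * p0) / 320 * (5 / 2 * ln (real (card T)))"
      by (intro mult_left_mono) auto
    then show ?thesis by (simp add: L_def mult_ac)
  qed
  ultimately show ?thesis by (meson ennreal_leI order_trans)
qed

section \<open>The minimax lower bound\<close>

text \<open>
  In the second case \<open>r \<le> 2 * p0\<close>, so the dimension term alone suffices; this costs the factor 2
  between the constants \<open>1 / 4096\<close> and \<open>1 / 8192\<close>.
\<close>

theorem theorem2:
  shows "\<exists>C::real. C > 0 \<and>
    (\<forall>(n::nat) (p::nat) (X::real mat) (\<sigma>::real) (A::nat set set) (p0::nat) (r::nat) (m::nat \<Rightarrow> nat).
       X \<in> carrier_mat n p \<longrightarrow>
       r = mat_rank X \<longrightarrow>
       any_rank_cols_indpt X \<longrightarrow>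
       \<sigma> > 0 \<longrightarrow>
       admissible_family X A \<longrightarrow>
       m = (\<lambda>k. card (models_of_size A k)) \<longrightarrow>
       1 \<le> p0 \<longrightarrow> p0 \<le> r \<longrightarrow>
       m p0 \<ge> 1 \<longrightarrow>
         (real p0 \<le> real r / 2 \<longrightarrow>
            minimax_risk X \<sigma> A p0 \<ge>
              ennreal (C * \<sigma>\<^sup>2 * max (tau X (2 * p0) * (ln (real (m p0)) / max 1 (ln (real p0))))
                                   (tau X p0 * real p0))) \<and>
         (real r / 2 \<le> real p0 \<longrightarrow>
            minimax_risk X \<sigma> A p0 \<ge> ennreal (C * \<sigma>\<^sup>2 * tau X p0 * real r)))"
proof (intro exI[of _ "1 / 8192"] conjI allI impI)
  fix n p :: nat and X :: "real mat" and \<sigma> :: real and A :: "nat set set" and p0 r :: nat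
    and m :: "nat \<Rightarrow> nat"
  assume X: "X \<in> carrier_mat n p" and \<sigma>: "\<sigma> > 0" and A: "admissible_family X A"
    and m: "m = (\<lambda>k. card (models_of_size A k))" and p0: "1 \<le> p0" and m1: "m p0 \<ge> 1"
  have sub: "M \<subseteq> {..<p}" if "M \<in> A" for M using A X that by (auto simp: admissible_family_def)
  have "models_of_size A p0 \<noteq> {}" using m1 by (auto simp: m)
  then obtain M where M: "M \<in> A" "card M = p0" by (auto simp: models_of_size_def)
  have p: "p \<ge> 1" using sub[OF M(1)] M(2) p0 by (cases p) auto
  have tau: "tau X k \<ge> 0" if "k \<ge> 1" for k using phi_nonneg[of X k] X p that by (simp add: tau_def)
  have dimension: "minimax_risk X \<sigma> A p0 \<ge> ennreal (\<sigma>\<^sup>2 * tau X p0 * real p0 / 4096)"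
    by (rule minimax_risk_ge_dimension[OF X \<sigma> p0 M(1) sub[OF M(1)] M(2)])
  define q where "q = ln (real (m p0)) / max 1 (ln (real p0))"
  have q: "q \<ge> 0" using m1 by (simp add: q_def)
  have logs: "minimax_risk X \<sigma> A p0 \<ge> ennreal (\<sigma>\<^sup>2 * tau X (2 * p0) * q / 320)"
    using minimax_risk_ge_log_card_models[where m="m p0", OF X \<sigma> p0 sub] m1 by (simp add: m q_def)
  show "minimax_risk X \<sigma> A p0 \<ge> ennreal (1 / 8192 * \<sigma>\<^sup>2 * max (tau X (2 * p0) * q) (tau X p0 * real p0))"
  proof (cases "tau X (2 * p0) * q \<le> tau X p0 * real p0")
    case True
    have "1 / 8192 * (\<sigma>\<^sup>2 * tau X p0 * real p0) \<le> 1 / 4096 * (\<sigma>\<^sup>2 * tau X p0 * real p0)"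
      using tau[OF p0] by (intro mult_right_mono) auto
    then have "1 / 8192 * \<sigma>\<^sup>2 * max (tau X (2 * p0) * q) (tau X p0 * real p0) \<le> \<sigma>\<^sup>2 * tau X p0 * real p0 / 4096"
      using True by (simp add: max_def mult_ac)
    with dimension show ?thesis by (meson ennreal_leI order_trans)
  next
    case False
    have "1 / 8192 * (\<sigma>\<^sup>2 * tau X (2 * p0) * q) \<le> 1 / 320 * (\<sigma>\<^sup>2 * tau X (2 * p0) * q)"
      using tau[of "2 * p0"] p0 q by (intro mult_right_mono) auto
    then have "1 / 8192 * \<sigma>\<^sup>2 * max (tau X (2 * p0) * q) (tau X p0 * real p0) \<le> \<sigma>\<^sup>2 * tau X (2 * p0) * q / 320"
      using False by (simp add: max_def mult_ac)
    with logs show ?thesis by (meson ennreal_leI order_trans)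
  qed
  assume "real r / 2 \<le> real p0"
  then have "1 / 8192 * \<sigma>\<^sup>2 * tau X p0 * real r \<le> 1 / 8192 * \<sigma>\<^sup>2 * tau X p0 * (2 * real p0)"
    using tau[OF p0] by (intro mult_left_mono) auto
  then have "1 / 8192 * \<sigma>\<^sup>2 * tau X p0 * real r \<le> \<sigma>\<^sup>2 * tau X p0 * real p0 / 4096"
    by (simp add: mult_ac)
  with dimension show "minimax_risk X \<sigma> A p0 \<ge> ennreal (1 / 8192 * \<sigma>\<^sup>2 * tau X p0 * real r)"
    by (meson ennreal_leI order_trans)
qed simp

end
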